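(* Let $\mathscr{P}$ be a closed hereditary topological property that is both invariant and inverse invariant under perfect continuous surjections. Then the perfect continuous image of any $\mathscr{P}$-connected space is $\mathscr{P}$-connected; that is, if $X$ is a $\mathscr{P}$-connected space and $f:X\to Y$ is a perfect continuous surjection, then $Y$ is $\mathscr{P}$-connected.
   Context: A topological property is a property of topological spaces invariant under homeomorphism. A mapping $f:X\to Y$ is perfect if it is closed and continuous and each fiber $f^{-1}(y)$, $y\in Y$, is a compact subspace of $X$. $\mathscr{P}$ is closed hereditary if every closed subspace of a space with $\mathscr{P}$ has $\mathscr{P}$. $\mathscr{P}$ is invariant (respectively, inverse invariant) under perfect continuous surjections if for every perfect continuous surjection $f:X\to Y$, the space $Y$ has $\mathscr{P}$ whenever $X$ has $\mathscr{P}$ (respectively, $X$ has $\mathscr{P}$ whenever $Y$ has $\mathscr{P}$). A zero-set of a space $X$ is a set $f^{-1}(0)$ with $f:X\to[0,1]$ continuous; a cozero-set of $X$ is the complement in $X$ of a zero-set. $\mathrm{Coz}(X)$ denotes the set of all cozero-sets of $X$. A $\mathscr{P}$-separation for a space $X$ is a pair $C,D\in\mathrm{Coz}(X)$ such that: $C$ and $D$ are disjoint; neither $\mathrm{cl}_XC$ nor $\mathrm{cl}_XD$ has $\mathscr{P}$; and $X\setminus(C\cup D)\subseteq E$ for some $E\in\mathrm{Coz}(X)$ such that $\mathrm{cl}_XE$ has $\mathscr{P}$. The space $X$ is $\mathscr{P}$-disconnected if there is a $\mathscr{P}$-separation for it, and $\mathscr{P}$-connected otherwise. *)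

theory Defs
  imports "HOL-Analysis.Analysis"
begin

text \<open>
  A property of topological spaces is a predicate \<open>P\<close> on \<open>'a topology\<close>, so all spaces concerned
  live on subsets of one arbitrary type \<open>'a\<close>. This class contains all subspaces of its members
  and, up to homeomorphism, all images of its members under surjections.
\<close>

definition topological_property :: "('a topology \<Rightarrow> bool) \<Rightarrow> bool" where
  "topological_property P \<longleftrightarrow> (\<forall>X Y. X homeomorphic_space Y \<longrightarrow> (P X \<longleftrightarrow> P Y))"

definition closed_hereditary :: "('a topology \<Rightarrow> bool) \<Rightarrow> bool" where
  "closed_hereditary P \<longleftrightarrow> (\<forall>X S. P X \<longrightarrow> closedin X S \<longrightarrow> P (subtopology X S))"

text \<open>The library's \<^const>\<open>perfect_map\<close> includes continuity and surjectivity.\<close>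

definition perfect_invariant :: "('a topology \<Rightarrow> bool) \<Rightarrow> bool" where
  "perfect_invariant P \<longleftrightarrow> (\<forall>X Y f. perfect_map X Y f \<longrightarrow> P X \<longrightarrow> P Y)"

definition perfect_inverse_invariant :: "('a topology \<Rightarrow> bool) \<Rightarrow> bool" where
  "perfect_inverse_invariant P \<longleftrightarrow> (\<forall>X Y f. perfect_map X Y f \<longrightarrow> P Y \<longrightarrow> P X)"

definition zero_set_in :: "'a topology \<Rightarrow> 'a set \<Rightarrow> bool" where
  "zero_set_in X Z \<longleftrightarrow>
    (\<exists>f. continuous_map X (top_of_set {0..1::real}) f \<and> Z = {x \<in> topspace X. f x = 0})"

definition Coz :: "'a topology \<Rightarrow> 'a set set" where
  "Coz X = {topspace X - Z | Z. zero_set_in X Z}"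

definition separation_mod :: "('a topology \<Rightarrow> bool) \<Rightarrow> 'a topology \<Rightarrow> 'a set \<Rightarrow> 'a set \<Rightarrow> bool" where
  "separation_mod P X C D \<longleftrightarrow>
    C \<in> Coz X \<and> D \<in> Coz X \<and> C \<inter> D = {} \<and>
    \<not> P (subtopology X (X closure_of C)) \<and>
    \<not> P (subtopology X (X closure_of D)) \<and>
    (\<exists>E \<in> Coz X. topspace X - (C \<union> D) \<subseteq> E \<and> P (subtopology X (X closure_of E)))"

definition disconnected_mod :: "('a topology \<Rightarrow> bool) \<Rightarrow> 'a topology \<Rightarrow> bool" where
  "disconnected_mod P X \<longleftrightarrow> (\<exists>C D. separation_mod P X C D)"

definition connected_mod :: "('a topology \<Rightarrow> bool) \<Rightarrow> 'a topology \<Rightarrow> bool" where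
  "connected_mod P X \<longleftrightarrow> \<not> disconnected_mod P X"

end

theory Submission
  imports Defs
begin

text \<open>
  Cozero-sets pull back along \<open>f\<close>, so a separation \<open>(C, D)\<close> of \<open>Y\<close> pulls back to a pair of
  disjoint cozero-sets of \<open>X\<close>. Writing \<open>A'\<close> for the preimage of \<open>A\<close>, the map \<open>f\<close> restricts to
  perfect surjections from \<open>cl C'\<close> onto \<open>cl C\<close> and from \<open>(cl E)'\<close> onto \<open>cl E\<close>. Invariance along
  the former shows that \<open>cl C'\<close> lacks the property, inverse invariance along the latter that
  \<open>(cl E)'\<close> and hence its closed subspace \<open>cl E'\<close> has it.
\<close>

lemma Coz_preimage:
  assumes f: "continuous_map X Y f" and "C \<in> Coz Y"
  shows "{x \<in> topspace X. f x \<in> C} \<in> Coz X"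
proof -
  obtain g where g: "continuous_map Y (top_of_set {0..1::real}) g"
    and C: "C = topspace Y - {y \<in> topspace Y. g y = 0}"
    using assms unfolding Coz_def zero_set_in_def by auto
  have "continuous_map X (top_of_set {0..1::real}) (g \<circ> f)"
    using f g by (rule continuous_map_compose)
  \<comment> \<open>Since \<open>f x\<close> lies in \<open>topspace Y\<close>, the condition
    \<open>f x \<in> C\<close> amounts to \<open>g (f x) \<noteq> 0\<close>.\<close>
  moreover have "{x \<in> topspace X. f x \<in> C} = topspace X - {x \<in> topspace X. (g \<circ> f) x = 0}"
    using continuous_map_image_subset_topspace[OF f] unfolding C by auto
  ultimately show ?thesis
    unfolding Coz_def zero_set_in_def by blast
qed

lemma perfect_map_onto_image_of_closedin:
  assumes f: "perfect_map X Y f" and S: "closedin X S"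
  shows "perfect_map (subtopology X S) (subtopology Y (f ` S)) f"
proof -
  have "S \<subseteq> topspace X" using S by (rule closedin_subset)
  have proper: "proper_map X Y f" using f by (simp add: perfect_map_def)
  have "proper_map (subtopology X S) (subtopology Y (f ` S)) f"
    unfolding proper_map_def
  proof (intro conjI ballI)
    show "closed_map (subtopology X S) (subtopology Y (f ` S)) f"
      using proper S
      by (intro closed_map_into_subtopology closed_map_from_subtopology proper_imp_closed_map) auto
  next
    fix y assume "y \<in> topspace (subtopology Y (f ` S))"
    hence "compactin X (S \<inter> {x \<in> topspace X. f x = y})"
      using proper S by (intro closed_Int_compactin) (auto simp: proper_map_def)
    moreover have "S \<inter> {x \<in> topspace X. f x = y} = {x \<in> topspace (subtopology X S). f x = y}"
      by auto
    ultimately show "compactin (subtopology X S) {x \<in> topspace (subtopology X S). f x = y}"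
      by (auto simp: compactin_subtopology)
  qed
  moreover have "continuous_map (subtopology X S) (subtopology Y (f ` S)) f"
    using f unfolding perfect_map_def
    by (auto simp: continuous_map_in_subtopology continuous_map_from_subtopology)
  moreover have "f ` S \<subseteq> topspace Y"
    using f \<open>S \<subseteq> topspace X\<close> unfolding perfect_map_def by auto
  ultimately show ?thesis
    using \<open>S \<subseteq> topspace X\<close> unfolding perfect_map_def
    by (auto simp: Int_absorb1)
qed

text \<open>Continuity gives one inclusion and closedness of \<open>f\<close> the other, both for
  the closure of \<open>f\<close> ?C\<open>; surjectivity identifies\<close>f \<open>?C\<close> with
  \<open>C\<close>.\<close>

lemma image_closure_of_preimage:
  assumes f: "perfect_map X Y f" and C: "C \<subseteq> topspace Y"
  shows "f ` (X closure_of {x \<in> topspace X. f x \<in> C}) = Y closure_of C"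
proof -
  let ?C = "{x \<in> topspace X. f x \<in> C}"
  have "f ` (X closure_of ?C) = Y closure_of (f ` ?C)"
  proof
    show "f ` (X closure_of ?C) \<subseteq> Y closure_of (f ` ?C)"
      using f by (simp add: perfect_map_def continuous_map_image_closure_subset)
    show "Y closure_of (f ` ?C) \<subseteq> f ` (X closure_of ?C)"
      using f by (simp add: perfect_map_def proper_map_def closed_map_closure_of_image)
  qed
  also have "f ` ?C = C"
    using f C unfolding perfect_map_def by auto
  finally show ?thesis .
qed

lemma closure_of_preimage_has_property:
  assumes "closed_hereditary P" and inv: "perfect_inverse_invariant P"
    and f: "perfect_map X Y f"
    and P: "P (subtopology Y (Y closure_of E))"
  shows "P (subtopology X (X closure_of {x \<in> topspace X. f x \<in> E}))"
proof -
  let ?K = "{x \<in> topspace X. f x \<in> Y closure_of E}"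
  let ?E = "{x \<in> topspace X. f x \<in> E}"
  have cont: "continuous_map X Y f" and surj: "f ` topspace X = topspace Y"
    using f unfolding perfect_map_def by auto
  have K: "closedin X ?K"
    using cont by (rule closedin_continuous_map_preimage) simp
  \<comment> \<open>\<open>E\<close> is not assumed to lie in \<open>topspace Y\<close>, but every
    \<open>f x\<close> does, and \<open>topspace Y \<inter> E\<close> is contained in the closure of
    \<open>E\<close>.\<close>
  have "?E \<subseteq> ?K"
    using surj closure_of_subset_Int[of Y E] by auto
  hence sub: "X closure_of ?E \<subseteq> ?K"
    using K by (rule closure_of_minimal)
  \<comment> \<open>\<open>?K\<close> is a full preimage, so surjectivity makes its image all of the
    closure.\<close>
  have "f ` ?K = Y closure_of E"
    using surj closure_of_subset_topspace[of Y E] by auto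
  with perfect_map_onto_image_of_closedin[OF f K]
  have "perfect_map (subtopology X ?K) (subtopology Y (Y closure_of E)) f"
    by simp
  hence "P (subtopology X ?K)"
    using inv P unfolding perfect_inverse_invariant_def by blast
  moreover have "closedin (subtopology X ?K) (X closure_of ?E)"
    using sub by (simp add: closedin_subset_topspace)
  ultimately have "P (subtopology (subtopology X ?K) (X closure_of ?E))"
    using assms(1) unfolding closed_hereditary_def by blast
  with sub show ?thesis
    by (simp add: subtopology_subtopology Int_absorb1)
qed

text \<open>Applied in contrapositive form, to both \<open>C\<close> and \<open>D\<close>, for the
  two negated conjuncts of \<open>separation_mod\<close>.\<close>

lemma closure_of_has_property_if_preimage:
  assumes "perfect_invariant P" and f: "perfect_map X Y f" and "C \<subseteq> topspace Y"
    and "P (subtopology X (X closure_of {x \<in> topspace X. f x \<in> C}))"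
  shows "P (subtopology Y (Y closure_of C))"
  using assms perfect_map_onto_image_of_closedin[OF f closedin_closure_of]
    image_closure_of_preimage[OF f \<open>C \<subseteq> topspace Y\<close>]
  unfolding perfect_invariant_def by metis

lemma separation_mod_preimage:
  assumes "closed_hereditary P" "perfect_invariant P" "perfect_inverse_invariant P"
    and f: "perfect_map X Y f" and CD: "separation_mod P Y C D"
  shows "separation_mod P X {x \<in> topspace X. f x \<in> C} {x \<in> topspace X. f x \<in> D}"
proof -
  have cont: "continuous_map X Y f"
    using f by (simp add: perfect_map_def)
  \<comment> \<open>Cozero-sets are complements within the space, which gives the inclusions that
    \<open>closure_of_has_property_if_preimage\<close> requires.\<close>
  have "C \<subseteq> topspace Y" "D \<subseteq> topspace Y"
    using CD unfolding separation_mod_def Coz_def by auto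
  moreover obtain E where E: "E \<in> Coz Y" "topspace Y - (C \<union> D) \<subseteq> E"
    "P (subtopology Y (Y closure_of E))"
    using CD unfolding separation_mod_def by blast
  moreover have "topspace X - ({x \<in> topspace X. f x \<in> C} \<union> {x \<in> topspace X. f x \<in> D})
      \<subseteq> {x \<in> topspace X. f x \<in> E}"
    using E(2) continuous_map_image_subset_topspace[OF cont] by auto
  moreover have "{x \<in> topspace X. f x \<in> C} \<inter> {x \<in> topspace X. f x \<in> D} = {}"
    using CD unfolding separation_mod_def by auto
  ultimately show ?thesis
    using CD Coz_preimage[OF cont] closure_of_preimage_has_property[OF assms(1,3) f]
      closure_of_has_property_if_preimage[OF assms(2) f]
    unfolding separation_mod_def by meson
qed

theorem theorem5p1:
  fixes P :: "'a topology \<Rightarrow> bool"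
    and X Y :: "'a topology"
    and f :: "'a \<Rightarrow> 'a"
  assumes "topological_property P"
    and "closed_hereditary P"
    and "perfect_invariant P"
    and "perfect_inverse_invariant P"
    and "connected_mod P X"
    and "perfect_map X Y f"
  shows "connected_mod P Y"
  using assms separation_mod_preimage
  unfolding connected_mod_def disconnected_mod_def by blast

end
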